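(* Let $n\ge 1$, let $s\in\mathbb{R}^n$ be an initial vector and let $y\in\mathbb{R}^n$ be a received word (a vector of $\Lambda(s)$ having been transmitted over an AWGN channel). Suppose that the minimizer $\hat{x}=\arg\min_{x\in\Lambda(s)}\|y-x\|^2$ is unique. Put $C = y s^T\in\mathbb{R}^{n\times n}$ and let $X^*$ be an optimal solution of the linear program $$\text{maximize } \operatorname{trace}(C^T X)\quad\text{subject to } X\in\mathbb{R}^{n\times n},\ X\mathbf{1}=\mathbf{1},\ \mathbf{1}^T X=\mathbf{1}^T,\ X\ge 0 .$$ If $X^*$ is integral (all entries are integers), then $\hat{x}=X^* s$.
   Context: $\Pi_n$ is the set of $n\times n$ permutation matrices (0/1 matrices with every row sum and every column sum equal to 1). For $s\in\mathbb{R}^n$ (a column vector, entries not necessarily distinct), $\Lambda(s)=\{Xs : X\in\Pi_n\}$. $\mathbf{1}$ is the all-one column vector, $X\ge 0$ means entrywise non-negativity, and $\|\cdot\|$ is the Euclidean norm. *)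

theory Defs
  imports "HOL-Analysis.Analysis"
begin

definition permutation_matrices :: "(real^'n^'n) set" where
  "permutation_matrices =
     {X. (\<forall>i j. X $ i $ j \<in> {0, 1}) \<and>
         (\<forall>i. (\<Sum>j\<in>UNIV. X $ i $ j) = 1) \<and>
         (\<forall>j. (\<Sum>i\<in>UNIV. X $ i $ j) = 1)}"

definition perm_codewords :: "real^'n \<Rightarrow> (real^'n) set" where
  "perm_codewords s = (\<lambda>X. X *v s) ` permutation_matrices"

text \<open>On vectors, the constant \<open>1\<close> is the all-one vector.\<close>

definition lp_feasible :: "(real^'n^'n) set" where
  "lp_feasible =
     {X. X *v (1 :: real^'n) = 1 \<and> (1 :: real^'n) v* X = 1 \<and> (\<forall>i j. 0 \<le> X $ i $ j)}"

end

theory Submission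
  imports Defs
begin

text \<open>
  Permuting coordinates preserves the norm, so on the codewords minimizing \<open>\<parallel>y - x\<parallel>\<^sup>2\<close> amounts to
  maximizing \<open>y \<bullet> x\<close>, which for \<open>x = X s\<close> is the objective of the linear program.
  The integral feasible points are exactly the permutation matrices, so an integral optimum
  yields a minimizer over the codewords.
\<close>

lemma lp_feasible_iff:
  "X \<in> lp_feasible \<longleftrightarrow>
     (\<forall>i. (\<Sum>j\<in>UNIV. X $ i $ j) = 1) \<and> (\<forall>j. (\<Sum>i\<in>UNIV. X $ i $ j) = 1) \<and> (\<forall>i j. 0 \<le> X $ i $ j)"
  by (simp add: lp_feasible_def vec_eq_iff matrix_vector_mult_def vector_matrix_mult_def)

lemma permutation_matrices_subset_lp_feasible: "permutation_matrices \<subseteq> lp_feasible"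
proof
  fix X :: "real^'n^'n" assume X: "X \<in> permutation_matrices"
  have "0 \<le> X $ i $ j" for i j
  proof -
    have "X $ i $ j \<in> {0, 1}" using X by (simp add: permutation_matrices_def)
    then show ?thesis by auto
  qed
  with X show "X \<in> lp_feasible" by (simp add: lp_feasible_iff permutation_matrices_def)
qed

text \<open>Non-negativity bounds each entry by its row sum, which is 1, so an integer entry can
  only be 0 or 1.\<close>

lemma integral_lp_feasible_imp_permutation_matrix:
  assumes X: "X \<in> lp_feasible" and integral: "\<forall>i j. X $ i $ j \<in> \<int>"
  shows "X \<in> permutation_matrices"
proof -
  have "X $ i $ j \<in> {0, 1}" for i j
  proof -
    have "X $ i $ j \<le> (\<Sum>j\<in>UNIV. X $ i $ j)"
      using X by (intro member_le_sum) (auto simp: lp_feasible_iff)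
    then have le: "X $ i $ j \<le> 1" and ge: "0 \<le> X $ i $ j"
      using X by (auto simp: lp_feasible_iff)
    obtain k where k: "X $ i $ j = of_int k"
      using integral by (meson Ints_cases)
    with le ge have "k = 0 \<or> k = 1" by auto
    with k show ?thesis by auto
  qed
  with X show ?thesis by (simp add: permutation_matrices_def lp_feasible_iff)
qed

text \<open>Makes explicit that multiplying by \<open>X\<close> only selects coordinates: row
  \<open>i\<close> is the unit vector of some index \<open>k\<close>.\<close>

lemma permutation_matrix_row:
  assumes X: "X \<in> permutation_matrices"
  obtains k where "\<And>j. X $ i $ j = (if j = k then 1 else 0)"
proof -
  have X01: "X $ i $ j = 0 \<or> X $ i $ j = 1" for j
    using X by (auto simp: permutation_matrices_def)
  have row: "(\<Sum>j\<in>UNIV. X $ i $ j) = 1"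
    using X by (simp add: permutation_matrices_def)
  \<comment> \<open>If no entry were 1, all would be 0 and the row could not sum to 1.\<close>
  obtain k where k: "X $ i $ k = 1"
    using row X01 by (metis sum.neutral zero_neq_one)
  have "(\<Sum>j\<in>UNIV - {k}. X $ i $ j) = 0"
    using row k by (simp add: sum.remove[of UNIV k])
  moreover have "0 \<le> X $ i $ j" for j using X01[of j] by auto
  ultimately have "X $ i $ j = 0" if "j \<noteq> k" for j
    using that by (subst (asm) sum_nonneg_eq_0_iff) auto
  with k show thesis by (intro that[of k]) auto
qed

text \<open>The rows being unit vectors lets squaring pass inside each row sum; the column sums then
  count every squared coordinate of \<open>s\<close> exactly once.\<close>

lemma norm_permutation_matrix_mult:
  fixes s :: "real^'n"
  assumes X: "X \<in> permutation_matrices"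
  shows "norm (X *v s) = norm s"
proof -
  \<comment> \<open>Both sides equal \<open>s $ k * s $ k\<close>, where \<open>k\<close> is the
    position of the 1 in row \<open>i\<close>.\<close>
  have "(X *v s) $ i * (X *v s) $ i = (\<Sum>j\<in>UNIV. X $ i $ j * (s $ j * s $ j))" for i
  proof -
    obtain k where "\<And>j. X $ i $ j = (if j = k then 1 else 0)"
      using permutation_matrix_row[OF X] by blast
    then show ?thesis by (simp add: matrix_vector_mult_def if_distrib[of "\<lambda>a. a * _"] cong: if_cong)
  qed
  then have "(X *v s) \<bullet> (X *v s) = (\<Sum>i\<in>UNIV. \<Sum>j\<in>UNIV. X $ i $ j * (s $ j * s $ j))"
    by (simp add: inner_vec_def)
  also have "\<dots> = (\<Sum>j\<in>UNIV. (\<Sum>i\<in>UNIV. X $ i $ j) * (s $ j * s $ j))"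
    by (subst sum.swap) (simp add: sum_distrib_right)
  also have "\<dots> = s \<bullet> s"
    using X by (simp add: permutation_matrices_def inner_vec_def)
  finally show ?thesis by (simp add: norm_eq_sqrt_inner)
qed

text \<open>Both sides expand to the double sum of \<open>y $ i * s $ j * X $ i $ j\<close>, in
  different orders of summation.\<close>

lemma trace_transpose_outer_product_mult:
  fixes s y :: "real^'n" and X :: "real^'n^'n"
  shows "trace (transpose ((columnvector y :: real^1^'n) ** (rowvector s :: real^'n^1)) ** X)
           = y \<bullet> (X *v s)"
proof -
  have "trace (transpose ((columnvector y :: real^1^'n) ** (rowvector s :: real^'n^1)) ** X)
          = (\<Sum>j\<in>UNIV. \<Sum>i\<in>UNIV. y $ i * s $ j * X $ i $ j)"
    by (simp add: trace_def transpose_def matrix_matrix_mult_def columnvector_def rowvector_def)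
  also have "\<dots> = (\<Sum>i\<in>UNIV. \<Sum>j\<in>UNIV. y $ i * s $ j * X $ i $ j)"
    by (rule sum.swap)
  also have "\<dots> = y \<bullet> (X *v s)"
    by (simp add: inner_vec_def matrix_vector_mult_def sum_distrib_left mult_ac)
  finally show ?thesis .
qed

theorem theorem2:
  fixes s y xhat :: "real^'n" and C Xopt :: "real^'n^'n"
  assumes unique: "\<exists>!x. is_arg_min (\<lambda>x. (norm (y - x))\<^sup>2) (\<lambda>x. x \<in> perm_codewords s) x"
    and xhat: "is_arg_min (\<lambda>x. (norm (y - x))\<^sup>2) (\<lambda>x. x \<in> perm_codewords s) xhat"
    and C: "C = (columnvector y :: real^1^'n) ** (rowvector s :: real^'n^1)"
    and opt: "is_arg_max (\<lambda>X. trace (transpose C ** X)) (\<lambda>X. X \<in> lp_feasible) Xopt"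
    and integral: "\<forall>i j. Xopt $ i $ j \<in> \<int>"
  shows "xhat = Xopt *v s"
proof -
  have Xopt: "Xopt \<in> permutation_matrices"
    using opt integral by (auto simp: is_arg_max_def intro: integral_lp_feasible_imp_permutation_matrix)
  \<comment> \<open>Only the inner product depends on \<open>X\<close>, since \<open>X *v s\<close>
    has the norm of \<open>s\<close>.\<close>
  have dist: "(norm (y - X *v s))\<^sup>2 = (norm y)\<^sup>2 + (norm s)\<^sup>2 - 2 * (y \<bullet> (X *v s))"
    if "X \<in> permutation_matrices" for X
    using norm_permutation_matrix_mult[OF that, of s]
    by (simp add: power2_norm_eq_inner inner_diff_left inner_diff_right inner_commute norm_eq)
  \<comment> \<open>The linear program is a relaxation: its optimum dominates every permutation
    matrix, each being feasible.\<close>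
  have max: "y \<bullet> (X *v s) \<le> y \<bullet> (Xopt *v s)" if "X \<in> permutation_matrices" for X
    using opt that permutation_matrices_subset_lp_feasible
    by (auto simp: is_arg_max_linorder C trace_transpose_outer_product_mult)
  have "is_arg_min (\<lambda>x. (norm (y - x))\<^sup>2) (\<lambda>x. x \<in> perm_codewords s) (Xopt *v s)"
    using Xopt max by (auto simp: is_arg_min_linorder perm_codewords_def dist)
  \<comment> \<open>\<open>Xopt *v s\<close> and \<open>xhat\<close> are both minimizers, hence
    equal by uniqueness.\<close>
  with unique xhat show ?thesis by blast
qed

end
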